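(* Let $k\in\{2,3\}$, and let $\phi_1=\frac{a_1}{\Delta x}$, $\phi_2=\frac{a_2}{\Delta y}$, $\phi_*=\max\{\phi_1,\phi_2\}$, $\psi=\phi_1+\phi_2+2\phi_*$, $\mu_1=\frac{\phi_1}{\psi}$, $\mu_2=\frac{\phi_2}{\psi}$, $\omega=\frac{\phi_*}{\psi}$. Then the 2D convex decomposition $$\bar u_{ij}=\frac{\mu_1}{2}\sum_{q=1}^Q\omega_q^{\tt G}\left[u_{i-\frac12,q}^{+}+u_{i+\frac12,q}^{-}\right]+\frac{\mu_2}{2}\sum_{q=1}^Q\omega_q^{\tt G}\left[u_{q,j-\frac12}^{+}+u_{q,j+\frac12}^{-}\right]+\omega\sum_s p_{ij}(\hat x_s,\hat y_s),$$ where $(\hat x_s,\hat y_s)$ runs over the two internal nodes (one for each sign; counted twice if they coincide) $$\left(x_i,\ y_j\pm\frac{\Delta y}{2\sqrt3}\sqrt{\frac{\phi_*-\phi_2}{\phi_*}}\right)\ \text{if }\phi_1\ge\phi_2,\qquad\left(x_i\pm\frac{\Delta x}{2\sqrt3}\sqrt{\frac{\phi_*-\phi_1}{\phi_*}},\ y_j\right)\ \text{if }\phi_1<\phi_2,$$ is optimal among all feasible convex decompositions for $\mathbb P^k$; that is, it is feasible for $\mathbb P^k$ and, among all 2D convex decompositions feasible for $\mathbb P^k$, it attains the maximum of $$\min\left\{\frac{\omega_1^-\Delta x}{a_1},\frac{\omega_1^+\Delta x}{a_1},\frac{\omega_2^-\Delta y}{a_2},\frac{\omega_2^+\Delta y}{a_2}\right\}$$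 (for the displayed decomposition, $\omega_1^\pm=\mu_1/2$ and $\omega_2^\pm=\mu_2/2$).
   Context: $\mathbb P^k$ is the space of polynomials in two variables of total degree at most $k$. $\Omega_{ij}=[x_{i-\frac12},x_{i+\frac12}]\times[y_{j-\frac12},y_{j+\frac12}]$ is a rectangular cell with center $(x_i,y_j)$ and side lengths $\Delta x,\Delta y>0$; $a_1,a_2>0$ are given constants (maximum characteristic speeds in the $x$- and $y$-directions). For $p_{ij}\in\mathbb P^k$, $\bar u_{ij}=\frac1{\Delta x\Delta y}\int_{\Omega_{ij}}p_{ij}\,dx\,dy$. $\{x_{i,q}^{\tt G}\}_{q=1}^Q$ and $\{y_{j,q}^{\tt G}\}_{q=1}^Q$ are the $Q$-point Gauss quadrature nodes in $[x_{i-\frac12},x_{i+\frac12}]$ and $[y_{j-\frac12},y_{j+\frac12}]$, with positive weights $\omega_q^{\tt G}$ normalized by $\sum_{q=1}^Q\omega_q^{\tt G}=1$; $Q$ is fixed and such that the rule is exact for univariate polynomials of degree at most $k$ (typically $Q=k+1$). Set $$u_{i-\frac12,q}^{+}=p_{ij}(x_{i-\frac12},y_{j,q}^{\tt G}),\quad u_{i+\frac12,q}^{-}=p_{ij}(x_{i+\frac12},y_{j,q}^{\tt G}),\quad u_{q,j-\frac12}^{+}=p_{ij}(x_{i,q}^{\tt G},y_{j-\frac12}),\quad u_{q,j+\frac12}^{-}=p_{ij}(x_{i,q}^{\tt G},y_{j+\frac12}).$$ A 2D convex decomposition $$\bar u_{ij}=\sum_{q=1}^Q\omega_q^{\tt G}\left[\omega_1^-u_{i-\frac12,q}^++\omega_1^+u_{i+\frac12,q}^-+\omega_2^-u_{q,j-\frac12}^++\omega_2^+u_{q,j+\frac12}^-\right]+\sum_{s=1}^S\omega_s\,p_{ij}(x_{ij}^{(s)},y_{ij}^{(s)})$$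 is called feasible for $\mathbb P^k$ if (i) it holds exactly for all $p_{ij}\in\mathbb P^k$; (ii) the weights $\omega_1^\pm,\omega_2^\pm,\omega_s$ are all positive (they sum to one); (iii) all internal nodes $(x_{ij}^{(s)},y_{ij}^{(s)})$ lie in $\Omega_{ij}$. The number $S$ of internal nodes is arbitrary. A feasible decomposition is called optimal if it yields the mildest bound-preserving CFL condition $\Delta t\le c_0\min\left\{\frac{\omega_1^-\Delta x}{a_1},\frac{\omega_1^+\Delta x}{a_1},\frac{\omega_2^-\Delta y}{a_2},\frac{\omega_2^+\Delta y}{a_2}\right\}$ (with $c_0>0$ a fixed constant), i.e. it maximizes this minimum over all feasible decompositions. *)

theory Defs
  imports "HOL-Analysis.Analysis" "HOL-Computational_Algebra.Polynomial"
begin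

definition poly2 :: "nat \<Rightarrow> (real \<times> real \<Rightarrow> real) set"
  where "poly2 k =
    {p. \<exists>c :: nat \<Rightarrow> nat \<Rightarrow> real. \<forall>x y. p (x, y) = (\<Sum>i\<le>k. \<Sum>j\<le>k - i. c i j * x ^ i * y ^ j)}"

definition cell :: "real \<Rightarrow> real \<Rightarrow> real \<Rightarrow> real \<Rightarrow> (real \<times> real) set"
  where "cell x\<^sub>0 y\<^sub>0 dx dy = {x\<^sub>0 - dx / 2 .. x\<^sub>0 + dx / 2} \<times> {y\<^sub>0 - dy / 2 .. y\<^sub>0 + dy / 2}"

definition cell_average ::
    "real \<Rightarrow> real \<Rightarrow> real \<Rightarrow> real \<Rightarrow> (real \<times> real \<Rightarrow> real) \<Rightarrow> real"
  where "cell_average x\<^sub>0 y\<^sub>0 dx dy p = 1 / (dx * dy) * integral (cell x\<^sub>0 y\<^sub>0 dx dy) p"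

text \<open>Quadrature rules are normalized: they approximate the mean value over an interval, and the
  weights sum to one. A \<open>Q\<close>-point Gauss rule is the \<open>Q\<close>-point rule that is exact up to degree
  \<open>2 * Q - 1\<close>; this determines it up to the numbering of its nodes.\<close>

definition quadrature_exact ::
    "real \<Rightarrow> real \<Rightarrow> nat \<Rightarrow> (nat \<Rightarrow> real) \<Rightarrow> (nat \<Rightarrow> real) \<Rightarrow> nat \<Rightarrow> bool"
  where "quadrature_exact a b Q z w d \<longleftrightarrow>
    (\<forall>f :: real poly. degree f \<le> d \<longrightarrow>
       (\<Sum>q = 1..Q. w q * poly f (z q)) = 1 / (b - a) * integral {a..b} (poly f))"

definition gauss_rule :: "real \<Rightarrow> real \<Rightarrow> nat \<Rightarrow> (nat \<Rightarrow> real) \<Rightarrow> (nat \<Rightarrow> real) \<Rightarrow> bool"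
  where "gauss_rule a b Q z w \<longleftrightarrow>
    Q \<ge> 1 \<and> inj_on z {1..Q} \<and> z ` {1..Q} \<subseteq> {a..b} \<and>
    (\<forall>q\<in>{1..Q}. w q > 0) \<and> (\<Sum>q = 1..Q. w q) = 1 \<and>
    quadrature_exact a b Q z w (2 * Q - 1)"

text \<open>The data of a decomposition: the weights \<open>\<omega>\<^sub>1\<^sup>-\<close>, \<open>\<omega>\<^sub>1\<^sup>+\<close>, \<open>\<omega>\<^sub>2\<^sup>-\<close>, \<open>\<omega>\<^sub>2\<^sup>+\<close> of the left, right, bottom
  and top edge, and the internal nodes with their weights, numbered from \<open>1\<close> to \<open>num_inner\<close>; the
  values of \<open>inner_weight\<close> and \<open>inner_node\<close> at other indices are irrelevant. Internal nodes may
  coincide.\<close>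

record decomposition =
  weight1_minus :: real
  weight1_plus :: real
  weight2_minus :: real
  weight2_plus :: real
  num_inner :: nat
  inner_weight :: "nat \<Rightarrow> real"
  inner_node :: "nat \<Rightarrow> real \<times> real"

text \<open>Here \<open>X\<close> and \<open>Y\<close> are the quadrature nodes in the two sides of the cell and \<open>w\<close> their common
  weights.\<close>

definition decomposition_value ::
    "real \<Rightarrow> real \<Rightarrow> real \<Rightarrow> real \<Rightarrow> nat \<Rightarrow> (nat \<Rightarrow> real) \<Rightarrow> (nat \<Rightarrow> real) \<Rightarrow> (nat \<Rightarrow> real) \<Rightarrow>
      decomposition \<Rightarrow> (real \<times> real \<Rightarrow> real) \<Rightarrow> real"
  where "decomposition_value x\<^sub>0 y\<^sub>0 dx dy Q X Y w D p =
    (\<Sum>q = 1..Q. w q *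
       (weight1_minus D * p (x\<^sub>0 - dx / 2, Y q) + weight1_plus D * p (x\<^sub>0 + dx / 2, Y q) +
        weight2_minus D * p (X q, y\<^sub>0 - dy / 2) + weight2_plus D * p (X q, y\<^sub>0 + dy / 2))) +
    (\<Sum>s = 1..num_inner D. inner_weight D s * p (inner_node D s))"

definition feasible_decomposition ::
    "nat \<Rightarrow> real \<Rightarrow> real \<Rightarrow> real \<Rightarrow> real \<Rightarrow> nat \<Rightarrow> (nat \<Rightarrow> real) \<Rightarrow> (nat \<Rightarrow> real) \<Rightarrow> (nat \<Rightarrow> real) \<Rightarrow>
      decomposition \<Rightarrow> bool"
  where "feasible_decomposition k x\<^sub>0 y\<^sub>0 dx dy Q X Y w D \<longleftrightarrow>
    (\<forall>p \<in> poly2 k. cell_average x\<^sub>0 y\<^sub>0 dx dy p = decomposition_value x\<^sub>0 y\<^sub>0 dx dy Q X Y w D p) \<and>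
    weight1_minus D > 0 \<and> weight1_plus D > 0 \<and> weight2_minus D > 0 \<and> weight2_plus D > 0 \<and>
    (\<forall>s\<in>{1..num_inner D}. inner_weight D s > 0) \<and>
    weight1_minus D + weight1_plus D + weight2_minus D + weight2_plus D +
      (\<Sum>s = 1..num_inner D. inner_weight D s) = 1 \<and>
    (\<forall>s\<in>{1..num_inner D}. inner_node D s \<in> cell x\<^sub>0 y\<^sub>0 dx dy)"

text \<open>The CFL condition reads \<open>dt \<le> c\<^sub>0 * cfl_min dx dy a\<^sub>1 a\<^sub>2 D\<close> with a constant \<open>c\<^sub>0 > 0\<close> that does
  not depend on the decomposition \<open>D\<close>.\<close>

definition cfl_min :: "real \<Rightarrow> real \<Rightarrow> real \<Rightarrow> real \<Rightarrow> decomposition \<Rightarrow> real"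
  where "cfl_min dx dy a\<^sub>1 a\<^sub>2 D =
    Min {weight1_minus D * dx / a\<^sub>1, weight1_plus D * dx / a\<^sub>1,
         weight2_minus D * dy / a\<^sub>2, weight2_plus D * dy / a\<^sub>2}"

definition optimal_decomposition ::
    "nat \<Rightarrow> real \<Rightarrow> real \<Rightarrow> real \<Rightarrow> real \<Rightarrow> real \<Rightarrow> real \<Rightarrow> nat \<Rightarrow> (nat \<Rightarrow> real) \<Rightarrow> (nat \<Rightarrow> real) \<Rightarrow>
      (nat \<Rightarrow> real) \<Rightarrow> decomposition \<Rightarrow> bool"
  where "optimal_decomposition k x\<^sub>0 y\<^sub>0 dx dy a\<^sub>1 a\<^sub>2 Q X Y w D \<longleftrightarrow>
    feasible_decomposition k x\<^sub>0 y\<^sub>0 dx dy Q X Y w D \<and>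
    (\<forall>D'. feasible_decomposition k x\<^sub>0 y\<^sub>0 dx dy Q X Y w D' \<longrightarrow>
       cfl_min dx dy a\<^sub>1 a\<^sub>2 D' \<le> cfl_min dx dy a\<^sub>1 a\<^sub>2 D)"

end

theory Submission
  imports Defs
begin

text \<open>
  In cell-centred coordinates \<open>\<xi>\<close>, \<open>\<eta>\<close> scaled to \<open>[-1, 1]\<close>, testing a feasible decomposition with
  \<open>\<xi>\<^sup>2\<close> and dropping the internal nodes leaves \<open>\<omega>\<^sub>1\<^sup>- + \<omega>\<^sub>1\<^sup>+ + (\<omega>\<^sub>2\<^sup>- + \<omega>\<^sub>2\<^sup>+) / 3 \<le> 1 / 3\<close>, hence a
  minimum \<open>m\<close> satisfies \<open>2 m (3 \<phi>\<^sub>1 + \<phi>\<^sub>2) \<le> 1\<close>; testing with \<open>\<eta>\<^sup>2\<close> swaps the roles of \<open>\<phi>\<^sub>1\<close> and \<open>\<phi>\<^sub>2\<close>.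
  Together this is \<open>m \<le> 1 / (2 \<psi>)\<close>, the value of the displayed decomposition. Its internal nodes lie
  on the line where the sharper of the two tests vanishes, and their offset is fixed by the other one.
\<close>

section \<open>Moments of an interval and of the cell\<close>

text \<open>This is the mean value of \<open>x ^ n\<close> over the interval of length
  \<open>h\<close> centred at \<open>c\<close>, in closed form.\<close>

definition interval_moment :: "real \<Rightarrow> real \<Rightarrow> nat \<Rightarrow> real"
  where "interval_moment c h n =
    ((c + h / 2) ^ Suc n - (c - h / 2) ^ Suc n) / (real (Suc n) * h)"

lemma integral_power_interval_moment:
  fixes c h :: real
  assumes "h > 0"
  shows "integral {c - h / 2 .. c + h / 2} (\<lambda>x. x ^ n) = h * interval_moment c h n"
proof -
  have "((\<lambda>x. x ^ n) has_integral
      ((c + h / 2) ^ Suc n / real (Suc n) - (c - h / 2) ^ Suc n / real (Suc n)))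
      {c - h / 2 .. c + h / 2}"
  proof (rule fundamental_theorem_of_calculus)
    show "c - h / 2 \<le> c + h / 2"
      using assms by simp
    show "((\<lambda>x. x ^ Suc n / real (Suc n)) has_vector_derivative x ^ n)
        (at x within {c - h / 2 .. c + h / 2})" for x
      unfolding has_real_derivative_iff_has_vector_derivative [symmetric]
      by (rule derivative_eq_intros refl | simp)+
  qed
  then have "integral {c - h / 2 .. c + h / 2} (\<lambda>x. x ^ n) =
      (c + h / 2) ^ Suc n / real (Suc n) - (c - h / 2) ^ Suc n / real (Suc n)"
    by (rule integral_unique)
  also have "\<dots> = h * interval_moment c h n"
    using assms by (simp add: interval_moment_def diff_divide_distrib [symmetric] del: power_Suc of_nat_Suc)
  finally show ?thesis .
qed

lemma interval_moment_simps:
  assumes "h > 0"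
  shows "interval_moment c h 0 = 1"
    and "interval_moment c h (Suc 0) = c"
    and "interval_moment c h 2 = c\<^sup>2 + h\<^sup>2 / 12"
    and "interval_moment c h 3 = c ^ 3 + c * h\<^sup>2 / 4"
  using assms
  by (simp_all add: interval_moment_def field_simps power2_eq_square power3_eq_cube eval_nat_numeral)

lemma quadrature_exact_power:
  assumes "quadrature_exact (c - h / 2) (c + h / 2) Q z w d" and "h > 0" and "n \<le> d"
  shows "(\<Sum>q = 1..Q. w q * z q ^ n) = interval_moment c h n"
proof -
  have poly_monom_eq: "poly (monom 1 n) = (\<lambda>x :: real. x ^ n)"
    by (simp add: fun_eq_iff poly_monom)
  have "degree (monom (1 :: real) n) \<le> d"
    using assms(3) by (simp add: degree_monom_eq)
  then have "(\<Sum>q = 1..Q. w q * z q ^ n) =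
      1 / (c + h / 2 - (c - h / 2)) * integral {c - h / 2 .. c + h / 2} (\<lambda>x. x ^ n)"
    using assms(1) unfolding quadrature_exact_def by (auto simp flip: poly_monom_eq simp: poly_monom)
  then show ?thesis
    using assms(2) by (simp add: integral_power_interval_moment)
qed

lemma cell_eq_cbox: "cell x y dx dy = cbox (x - dx / 2, y - dy / 2) (x + dx / 2, y + dy / 2)"
  by (simp add: cell_def cbox_Pair_eq)

lemma cell_average_monomial:
  assumes "dx > 0" and "dy > 0"
  shows "cell_average x y dx dy (\<lambda>z. fst z ^ i * snd z ^ j) =
    interval_moment x dx i * interval_moment y dy j"
proof -
  have "integral (cell x y dx dy) (\<lambda>z. fst z ^ i * snd z ^ j) =
      integral {x - dx / 2 .. x + dx / 2} (\<lambda>u. integral {y - dy / 2 .. y + dy / 2} (\<lambda>v. u ^ i * v ^ j))"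
    unfolding cell_eq_cbox
    by (subst integral_prod_continuous) (auto intro!: continuous_intros)
  also have "\<dots> = (dx * interval_moment x dx i) * (dy * interval_moment y dy j)"
    using assms by (simp add: integral_power_interval_moment)
  finally show ?thesis
    using assms by (simp add: cell_average_def)
qed

section \<open>Reduction of exactness to monomials\<close>

lemma cell_average_scale: "cell_average x y dx dy (\<lambda>z. c * f z) = c * cell_average x y dx dy f"
  by (simp add: cell_average_def)

lemma cell_average_sum:
  assumes "finite I" and "\<And>i. i \<in> I \<Longrightarrow> continuous_on UNIV (f i)"
  shows "cell_average x y dx dy (\<lambda>z. \<Sum>i\<in>I. f i z) = (\<Sum>i\<in>I. cell_average x y dx dy (f i))"
proof -
  have "f i integrable_on cell x y dx dy" if "i \<in> I" for i
    unfolding cell_eq_cbox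
    by (intro integrable_continuous continuous_on_subset [OF assms(2) [OF that]]) simp
  then show ?thesis
    using assms(1) by (simp add: cell_average_def integral_sum sum_distrib_left)
qed

lemma decomposition_value_scale:
  "decomposition_value x y dx dy Q X Y w D (\<lambda>z. c * f z) =
    c * decomposition_value x y dx dy Q X Y w D f"
  by (simp add: decomposition_value_def sum_distrib_left algebra_simps)

lemma decomposition_value_sum:
  assumes "finite I"
  shows "decomposition_value x y dx dy Q X Y w D (\<lambda>z. \<Sum>i\<in>I. f i z) =
    (\<Sum>i\<in>I. decomposition_value x y dx dy Q X Y w D (f i))"
  using assms
proof (induction I rule: finite_induct)
  case empty
  then show ?case by (simp add: decomposition_value_def)
next
  case (insert i I)
  then show ?case by (simp add: decomposition_value_def algebra_simps sum.distrib)
qed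

text \<open>Both sides are linear in the polynomial. For the cell average this rests on
  integrability, which continuity of the monomials supplies.\<close>

lemma decomposition_exact_poly2I:
  assumes "\<And>i j. i + j \<le> k \<Longrightarrow>
      cell_average x y dx dy (\<lambda>z. fst z ^ i * snd z ^ j) =
      decomposition_value x y dx dy Q X Y w D (\<lambda>z. fst z ^ i * snd z ^ j)"
    and "p \<in> poly2 k"
  shows "cell_average x y dx dy p = decomposition_value x y dx dy Q X Y w D p"
proof -
  obtain c where "\<And>x y. p (x, y) = (\<Sum>i\<le>k. \<Sum>j\<le>k - i. c i j * x ^ i * y ^ j)"
    using assms(2) unfolding poly2_def by blast
  then have p: "p = (\<lambda>z. \<Sum>i\<le>k. \<Sum>j\<le>k - i. c i j * (fst z ^ i * snd z ^ j))"
    by (auto simp: fun_eq_iff mult.assoc)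
  have cont: "continuous_on UNIV (\<lambda>z. c i j * (fst z ^ i * snd z ^ j))" for i j
    by (intro continuous_intros)
  have "cell_average x y dx dy p =
      (\<Sum>i\<le>k. \<Sum>j\<le>k - i. c i j * cell_average x y dx dy (\<lambda>z. fst z ^ i * snd z ^ j))"
    unfolding p
    by (subst cell_average_sum)
      (auto intro!: continuous_on_sum cont simp: cell_average_sum [OF _ cont] cell_average_scale)
  also have "\<dots> = (\<Sum>i\<le>k. \<Sum>j\<le>k - i.
      c i j * decomposition_value x y dx dy Q X Y w D (\<lambda>z. fst z ^ i * snd z ^ j))"
    by (intro sum.cong refl) (simp add: assms(1))
  also have "\<dots> = decomposition_value x y dx dy Q X Y w D p"
    unfolding p by (simp add: decomposition_value_sum decomposition_value_scale)
  finally show ?thesis .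
qed

lemma monomial_in_poly2:
  assumes "i + j \<le> k"
  shows "(\<lambda>z. fst z ^ i * snd z ^ j) \<in> poly2 k"
proof -
  \<comment> \<open>The nested conditionals let the two sums collapse one at a time;
    \<open>i + j \<le> k\<close> puts both indices in range.\<close>
  have "(\<Sum>i'\<le>k. \<Sum>j'\<le>k - i'. (if i' = i then if j' = j then 1 else 0 else 0) * x ^ i' * y ^ j') =
      x ^ i * y ^ j" for x y :: real
  proof -
    have "(\<Sum>j'\<le>k - i'. (if i' = i then if j' = j then 1 else 0 else 0) * x ^ i' * y ^ j') =
        (if i' = i then x ^ i * y ^ j else 0)" for i'
      using assms by (auto simp: if_distrib [of "\<lambda>t. t * _"] cong: if_cong)
    then show ?thesis
      using assms by simp
  qed
  then show ?thesis
    unfolding poly2_def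
    by (intro CollectI exI [of _ "\<lambda>i' j'. if i' = i then if j' = j then 1 else 0 else 0"]) simp
qed

text \<open>On an edge one factor of the monomial is constant and the other is a univariate power of
  degree at most \<open>k\<close>, so the Gauss sum along the edge is an interval moment.\<close>

lemma decomposition_value_monomial:
  assumes "quadrature_exact (x - dx / 2) (x + dx / 2) Q X w k" and "dx > 0" and "i \<le> k"
    and "quadrature_exact (y - dy / 2) (y + dy / 2) Q Y w k" and "dy > 0" and "j \<le> k"
  shows "decomposition_value x y dx dy Q X Y w D (\<lambda>z. fst z ^ i * snd z ^ j) =
    (weight1_minus D * (x - dx / 2) ^ i + weight1_plus D * (x + dx / 2) ^ i) * interval_moment y dy j +
    interval_moment x dx i * (weight2_minus D * (y - dy / 2) ^ j + weight2_plus D * (y + dy / 2) ^ j) +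
    (\<Sum>s = 1..num_inner D. inner_weight D s * (fst (inner_node D s) ^ i * snd (inner_node D s) ^ j))"
  unfolding decomposition_value_def
    quadrature_exact_power [OF assms(1-3), symmetric] quadrature_exact_power [OF assms(4-6), symmetric]
  by (simp add: sum_distrib_left sum_distrib_right sum.distrib algebra_simps)

section \<open>Exactness of symmetric decompositions in degree at most three\<close>

text \<open>The \<open>n\<close>-th moment, for \<open>n \<le> 3\<close>, of any distribution with variance \<open>v\<close> that is symmetric about \<open>c\<close>.
  It is affine in \<open>v\<close>, which reduces exactness of a symmetric decomposition to identities between
  variances.\<close>

definition symmetric_moment :: "real \<Rightarrow> real \<Rightarrow> nat \<Rightarrow> real"
  where "symmetric_moment c v n = c ^ n + real (n choose 2) * c ^ (n - 2) * v"

text \<open>The binomial coefficient vanishes here, which also makes the truncated exponent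
  \<open>n - 2\<close> harmless. In a monomial of total degree at most 3 one exponent is at most 1,
  so the variance in that coordinate has no effect.\<close>

lemma symmetric_moment_low_degree:
  assumes "n \<le> 1"
  shows "symmetric_moment c v n = c ^ n"
  using assms by (simp add: symmetric_moment_def)

lemma symmetric_moment_affine:
  assumes "p + q + r = 1"
  shows "p * symmetric_moment c u n + q * symmetric_moment c v n + r * symmetric_moment c w n =
    symmetric_moment c (p * u + q * v + r * w) n"
proof -
  have "p * symmetric_moment c u n + q * symmetric_moment c v n + r * symmetric_moment c w n =
      (p + q + r) * c ^ n + real (n choose 2) * c ^ (n - 2) * (p * u + q * v + r * w)"
    by (simp add: symmetric_moment_def algebra_simps)
  then show ?thesis
    by (simp add: assms symmetric_moment_def)
qed

lemma le_3_cases: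
  fixes n :: nat
  assumes "n \<le> 3"
  obtains "n = 0" | "n = Suc 0" | "n = 2" | "n = 3"
  using assms by linarith

text \<open>The uniform distribution on an interval of length \<open>h\<close> is symmetric with
  variance \<open>h\<^sup>2 / 12\<close>.\<close>

lemma interval_moment_eq_symmetric_moment:
  assumes "h > 0" and "n \<le> 3"
  shows "interval_moment c h n = symmetric_moment c (h\<^sup>2 / 12) n"
  using assms(2)
  by (cases n rule: le_3_cases)
    (simp_all add: interval_moment_simps assms(1) symmetric_moment_def choose_two)

lemma two_point_moment_eq_symmetric_moment:
  assumes "n \<le> 3"
  shows "(c - d) ^ n + (c + d) ^ n = 2 * symmetric_moment c (d\<^sup>2) n"
  using assms
  by (cases n rule: le_3_cases)
    (simp_all add: symmetric_moment_def choose_two power2_eq_square power3_eq_cube algebra_simps)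

text \<open>Since one exponent is at most 1, only the variances in the other coordinate must
  balance. In \<open>x\<close> the balance amounts to \<open>3 * m + n = 1\<close>; in
  \<open>y\<close> the last hypothesis on \<open>d\<close> is needed as well. The inner nodes are
  offset in \<open>y\<close> only; the other orientation follows by exchanging the
  coordinates.\<close>

lemma symmetric_decomposition_monomial:
  fixes x y :: real
  assumes "i + j \<le> 3" and "h > 0" and "g > 0"
    and "3 * m + n = 1" and "m * d\<^sup>2 = (m - n) * g\<^sup>2 / 12"
  shows "interval_moment x h i * interval_moment y g j =
    m / 2 * ((x - h / 2) ^ i + (x + h / 2) ^ i) * interval_moment y g j +
    n / 2 * interval_moment x h i * ((y - g / 2) ^ j + (y + g / 2) ^ j) +
    m * x ^ i * ((y - d) ^ j + (y + d) ^ j)"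
proof -
  note [simp] = interval_moment_eq_symmetric_moment two_point_moment_eq_symmetric_moment
    power_divide assms(2,3)
  \<comment> \<open>\<open>M\<close> and \<open>M'\<close> belong to the uniform distribution,
    \<open>N\<close> and \<open>N'\<close> to a pair of opposite edges, \<open>D'\<close> to the
    pair of inner nodes; primes mark the second coordinate.\<close>
  define M where "M = symmetric_moment x (h\<^sup>2 / 12) i"
  define N where "N = symmetric_moment x (h\<^sup>2 / 4) i"
  define M' where "M' = symmetric_moment y (g\<^sup>2 / 12) j"
  define N' where "N' = symmetric_moment y (g\<^sup>2 / 4) j"
  define D' where "D' = symmetric_moment y (d\<^sup>2) j"
  have n: "n = 1 - 3 * m" and total: "m + n + 2 * m = 1"
    using assms(4) by simp_all
  have "M * M' = m * N * M' + n * M * N' + 2 * m * x ^ i * D'"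
  proof (cases "i \<le> 1")
    case True
    have "m * (g\<^sup>2 / 12) + n * (g\<^sup>2 / 4) + (2 * m) * d\<^sup>2 = g\<^sup>2 / 12"
      unfolding mult.assoc assms(5) by (simp add: n field_simps)
    then have "M' = m * M' + n * N' + (2 * m) * D'"
      unfolding M'_def N'_def D'_def symmetric_moment_affine [OF total] by (simp only:)
    then have "x ^ i * M' = x ^ i * (m * M' + n * N' + (2 * m) * D')"
      by simp
    then show ?thesis
      using True by (simp add: M_def N_def symmetric_moment_low_degree algebra_simps)
  next
    case False
    \<comment> \<open>Both inner nodes have first coordinate \<open>x\<close>, hence variance
      0.\<close>
    have "m * (h\<^sup>2 / 4) + n * (h\<^sup>2 / 12) + (2 * m) * 0 = h\<^sup>2 / 12"
      by (simp add: n field_simps)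
    then have "M = m * N + n * M + (2 * m) * symmetric_moment x 0 i"
      unfolding M_def N_def symmetric_moment_affine [OF total] by (simp only:)
    then have "y ^ j * M = y ^ j * (m * N + n * M + (2 * m) * x ^ i)"
      by (simp add: symmetric_moment_def)
    then show ?thesis
      using False assms(1)
      by (simp add: M'_def N'_def D'_def symmetric_moment_low_degree algebra_simps)
  qed
  then show ?thesis
    using assms(1) by (simp add: M_def N_def M'_def N'_def D'_def)
qed

section \<open>Upper bounds on the edge weights\<close>

text \<open>About the cell centre, the second moment in \<open>x\<close> is
  \<open>dx\<^sup>2 / 4\<close> on the left and right edges but \<open>dx\<^sup>2 / 12\<close> on
  the bottom and top edges and on the whole cell; this ratio is the factor 3. The inner nodes
  contribute a nonnegative amount.\<close>

lemma feasible_edge_weight_bounds: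
  assumes "feasible_decomposition k x y dx dy Q X Y w D"
    and "quadrature_exact (x - dx / 2) (x + dx / 2) Q X w k"
    and "quadrature_exact (y - dy / 2) (y + dy / 2) Q Y w k"
    and "dx > 0" and "dy > 0" and "k \<ge> 2"
  shows "3 * (weight1_minus D + weight1_plus D) + (weight2_minus D + weight2_plus D) \<le> 1"
    and "(weight1_minus D + weight1_plus D) + 3 * (weight2_minus D + weight2_plus D) \<le> 1"
proof -
  define W1 where "W1 = weight1_minus D + weight1_plus D"
  define W2 where "W2 = weight2_minus D + weight2_plus D"
  define S where "S f = (\<Sum>s = 1..num_inner D. inner_weight D s * f (inner_node D s))" for f
  \<comment> \<open>The centred square is kept expanded in raw moments, the form in which exactness
    on monomials delivers it.\<close>
  have S_square: "S (\<lambda>z. (f z)\<^sup>2) - 2 * c * S f + c\<^sup>2 * S (\<lambda>z. 1) \<ge> 0" for f c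
  proof -
    have "S (\<lambda>z. (f z)\<^sup>2) - 2 * c * S f + c\<^sup>2 * S (\<lambda>z. 1) = S (\<lambda>z. (f z - c)\<^sup>2)"
      by (simp add: S_def sum_distrib_left sum.distrib sum_subtractf power2_eq_square algebra_simps)
    also have "\<dots> \<ge> 0"
      unfolding S_def using assms(1)
      by (intro sum_nonneg mult_nonneg_nonneg) (auto simp: feasible_decomposition_def intro: less_imp_le)
    finally show ?thesis .
  qed
  have exact: "interval_moment x dx i * interval_moment y dy j =
      (weight1_minus D * (x - dx / 2) ^ i + weight1_plus D * (x + dx / 2) ^ i) * interval_moment y dy j +
      interval_moment x dx i * (weight2_minus D * (y - dy / 2) ^ j + weight2_plus D * (y + dy / 2) ^ j) +
      S (\<lambda>z. fst z ^ i * snd z ^ j)" if "i + j \<le> 2" for i j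
  proof -
    have le: "i \<le> k" "j \<le> k" "i + j \<le> k"
      using that assms(6) by auto
    then have "cell_average x y dx dy (\<lambda>z. fst z ^ i * snd z ^ j) =
        decomposition_value x y dx dy Q X Y w D (\<lambda>z. fst z ^ i * snd z ^ j)"
      using assms(1) monomial_in_poly2 unfolding feasible_decomposition_def by blast
    then show ?thesis
      unfolding S_def cell_average_monomial [OF assms(4,5)]
        decomposition_value_monomial [OF assms(2,4) le(1) assms(3,5) le(2)] .
  qed
  have e0: "1 = W1 + W2 + S (\<lambda>z. 1)"
    using exact [of 0 0] assms(4,5) by (simp add: interval_moment_simps W1_def W2_def)
  have "dx\<^sup>2 / 12 = dx\<^sup>2 / 4 * W1 + dx\<^sup>2 / 12 * W2 + (S (\<lambda>z. (fst z)\<^sup>2) - 2 * x * S fst + x\<^sup>2 * S (\<lambda>z. 1))"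
  proof -
    have "x = weight1_minus D * (x - dx / 2) + weight1_plus D * (x + dx / 2) + x * W2 + S fst"
      using exact [of 1 0] assms(4,5) by (simp add: interval_moment_simps W2_def)
    moreover have "x\<^sup>2 + dx\<^sup>2 / 12 = weight1_minus D * (x - dx / 2)\<^sup>2 + weight1_plus D * (x + dx / 2)\<^sup>2 +
        (x\<^sup>2 + dx\<^sup>2 / 12) * W2 + S (\<lambda>z. (fst z)\<^sup>2)"
      using exact [of 2 0] assms(4,5) by (simp add: interval_moment_simps W2_def)
    \<comment> \<open>Second moment minus \<open>2 * x\<close> times the first plus
      \<open>x\<^sup>2\<close> times the zeroth: this passes to the moment about the cell
      centre.\<close>
    ultimately have "dx\<^sup>2 / 12 = (weight1_minus D * (x - dx / 2)\<^sup>2 + weight1_plus D * (x + dx / 2)\<^sup>2 +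
          (x\<^sup>2 + dx\<^sup>2 / 12) * W2 + S (\<lambda>z. (fst z)\<^sup>2)) -
        2 * x * (weight1_minus D * (x - dx / 2) + weight1_plus D * (x + dx / 2) + x * W2 + S fst) +
        x\<^sup>2 * (W1 + W2 + S (\<lambda>z. 1))"
      unfolding e0 [symmetric] by (simp add: power2_eq_square)
    then show ?thesis
      by (simp add: W1_def power2_eq_square algebra_simps)
  qed
  then have "dx\<^sup>2 * (3 * W1 + W2) \<le> dx\<^sup>2 * 1"
    using S_square [of fst x] by (simp add: algebra_simps)
  then show "3 * (weight1_minus D + weight1_plus D) + (weight2_minus D + weight2_plus D) \<le> 1"
    using assms(4) unfolding W1_def [symmetric] W2_def [symmetric]
    by (subst (asm) mult_le_cancel_left_pos) simp_all
  have "dy\<^sup>2 / 12 = dy\<^sup>2 / 12 * W1 + dy\<^sup>2 / 4 * W2 + (S (\<lambda>z. (snd z)\<^sup>2) - 2 * y * S snd + y\<^sup>2 * S (\<lambda>z. 1))"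
  proof -
    have "y = W1 * y + (weight2_minus D * (y - dy / 2) + weight2_plus D * (y + dy / 2)) + S snd"
      using exact [of 0 1] assms(4,5) by (simp add: interval_moment_simps W1_def)
    moreover have "y\<^sup>2 + dy\<^sup>2 / 12 = W1 * (y\<^sup>2 + dy\<^sup>2 / 12) +
        (weight2_minus D * (y - dy / 2)\<^sup>2 + weight2_plus D * (y + dy / 2)\<^sup>2) + S (\<lambda>z. (snd z)\<^sup>2)"
      using exact [of 0 2] assms(4,5) by (simp add: interval_moment_simps W1_def)
    ultimately have "dy\<^sup>2 / 12 = (W1 * (y\<^sup>2 + dy\<^sup>2 / 12) +
          (weight2_minus D * (y - dy / 2)\<^sup>2 + weight2_plus D * (y + dy / 2)\<^sup>2) + S (\<lambda>z. (snd z)\<^sup>2)) -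
        2 * y * (W1 * y + (weight2_minus D * (y - dy / 2) + weight2_plus D * (y + dy / 2)) + S snd) +
        y\<^sup>2 * (W1 + W2 + S (\<lambda>z. 1))"
      unfolding e0 [symmetric] by (simp add: power2_eq_square)
    then show ?thesis
      by (simp add: W2_def power2_eq_square algebra_simps)
  qed
  then have "dy\<^sup>2 * (W1 + 3 * W2) \<le> dy\<^sup>2 * 1"
    using S_square [of snd y] by (simp add: algebra_simps)
  then show "(weight1_minus D + weight1_plus D) + 3 * (weight2_minus D + weight2_plus D) \<le> 1"
    using assms(5) unfolding W1_def [symmetric] W2_def [symmetric]
    by (subst (asm) mult_le_cancel_left_pos) simp_all
qed

section \<open>The displayed decomposition and its optimality\<close>

text \<open>The first conclusion is the variance balance of
  \<open>symmetric_decomposition_monomial\<close> before division by \<psi>. It gives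
  \<open>d\<^sup>2 \<le> g\<^sup>2 / 12\<close>, so the nodes stay in the cell.\<close>

lemma internal_node_offset:
  fixes p q g d :: real
  assumes "q > 0" and "q \<le> p" and "g > 0" and "d = g / (2 * sqrt 3) * sqrt ((p - q) / p)"
  shows "p * d\<^sup>2 = (p - q) * g\<^sup>2 / 12" and "0 \<le> d" and "d \<le> g / 2"
proof -
  have "d\<^sup>2 = g\<^sup>2 / 12 * ((p - q) / p)"
    using assms by (simp add: power_mult_distrib power_divide)
  then show eq: "p * d\<^sup>2 = (p - q) * g\<^sup>2 / 12"
    using assms by simp
  show "0 \<le> d"
    using assms by simp
  have "p * d\<^sup>2 \<le> p * (g / 2)\<^sup>2"
    unfolding eq using assms by (simp add: power_divide mult_mono)
  then have "d\<^sup>2 \<le> (g / 2)\<^sup>2"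
    using assms by (subst (asm) mult_le_cancel_left_pos) simp_all
  then show "d \<le> g / 2"
    by (rule power2_le_imp_le) (use assms in simp)
qed

theorem theorem2:
  fixes k Q :: nat
    and x\<^sub>i y\<^sub>j dx dy a\<^sub>1 a\<^sub>2 \<phi>\<^sub>1 \<phi>\<^sub>2 \<phi>s \<psi> \<mu>\<^sub>1 \<mu>\<^sub>2 \<omega> :: real
    and X Y w :: "nat \<Rightarrow> real"
  assumes "k \<in> {2, 3}"
    and "dx > 0" and "dy > 0" and "a\<^sub>1 > 0" and "a\<^sub>2 > 0"
    and "gauss_rule (x\<^sub>i - dx / 2) (x\<^sub>i + dx / 2) Q X w"
    and "gauss_rule (y\<^sub>j - dy / 2) (y\<^sub>j + dy / 2) Q Y w"
    and "quadrature_exact (x\<^sub>i - dx / 2) (x\<^sub>i + dx / 2) Q X w k"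
    and "quadrature_exact (y\<^sub>j - dy / 2) (y\<^sub>j + dy / 2) Q Y w k"
    and "\<phi>\<^sub>1 = a\<^sub>1 / dx" and "\<phi>\<^sub>2 = a\<^sub>2 / dy" and "\<phi>s = max \<phi>\<^sub>1 \<phi>\<^sub>2"
    and "\<psi> = \<phi>\<^sub>1 + \<phi>\<^sub>2 + 2 * \<phi>s"
    and "\<mu>\<^sub>1 = \<phi>\<^sub>1 / \<psi>" and "\<mu>\<^sub>2 = \<phi>\<^sub>2 / \<psi>" and "\<omega> = \<phi>s / \<psi>"
  shows "optimal_decomposition k x\<^sub>i y\<^sub>j dx dy a\<^sub>1 a\<^sub>2 Q X Y w
    \<lparr>weight1_minus = \<mu>\<^sub>1 / 2, weight1_plus = \<mu>\<^sub>1 / 2,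
     weight2_minus = \<mu>\<^sub>2 / 2, weight2_plus = \<mu>\<^sub>2 / 2,
     num_inner = 2,
     inner_weight = (\<lambda>s. \<omega>),
     inner_node = (\<lambda>s. let \<sigma> = (if s = 1 then 1 else - 1) in
       if \<phi>\<^sub>1 \<ge> \<phi>\<^sub>2
       then (x\<^sub>i, y\<^sub>j + \<sigma> * (dy / (2 * sqrt 3) * sqrt ((\<phi>s - \<phi>\<^sub>2) / \<phi>s)))
       else (x\<^sub>i + \<sigma> * (dx / (2 * sqrt 3) * sqrt ((\<phi>s - \<phi>\<^sub>1) / \<phi>s)), y\<^sub>j))\<rparr>"
proof -
  define d where "d = (if \<phi>\<^sub>1 \<ge> \<phi>\<^sub>2 then dy / (2 * sqrt 3) * sqrt ((\<phi>s - \<phi>\<^sub>2) / \<phi>s)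
    else dx / (2 * sqrt 3) * sqrt ((\<phi>s - \<phi>\<^sub>1) / \<phi>s))"
  define node where "node s = (if \<phi>\<^sub>1 \<ge> \<phi>\<^sub>2 then (x\<^sub>i, y\<^sub>j + (if s = 1 then 1 else - 1) * d)
    else (x\<^sub>i + (if s = 1 then 1 else - 1) * d, y\<^sub>j))" for s :: nat
  define D where "D = \<lparr>weight1_minus = \<mu>\<^sub>1 / 2, weight1_plus = \<mu>\<^sub>1 / 2,
     weight2_minus = \<mu>\<^sub>2 / 2, weight2_plus = \<mu>\<^sub>2 / 2,
     num_inner = 2, inner_weight = (\<lambda>s. \<omega>), inner_node = node\<rparr>"
  have k: "2 \<le> k" "k \<le> 3"
    using assms(1) by auto
  have pos: "\<phi>\<^sub>1 > 0" "\<phi>\<^sub>2 > 0" "\<psi> > 0" "\<phi>s > 0"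
    using assms(2-5) unfolding assms(10-13) by (simp_all add: add_pos_pos max_def)
  \<comment> \<open>The index 1 appears as \<open>Suc 0\<close> after simplification.\<close>
  have atLeastAtMost_1_2: "{Suc 0..2} = {Suc 0, 2}"
    by auto
  \<comment> \<open>Exactness and the location of the nodes share the case distinction and the
    offset \<open>d\<close>.\<close>
  have exact_and_inside:
    "(i + j \<le> k \<longrightarrow> cell_average x\<^sub>i y\<^sub>j dx dy (\<lambda>z. fst z ^ i * snd z ^ j) =
      decomposition_value x\<^sub>i y\<^sub>j dx dy Q X Y w D (\<lambda>z. fst z ^ i * snd z ^ j)) \<and>
      node s \<in> cell x\<^sub>i y\<^sub>j dx dy" for i j s
  proof (cases "\<phi>\<^sub>1 \<ge> \<phi>\<^sub>2")
    case True
    then have \<phi>s: "\<phi>s = \<phi>\<^sub>1" and d: "d = dy / (2 * sqrt 3) * sqrt ((\<phi>\<^sub>1 - \<phi>\<^sub>2) / \<phi>\<^sub>1)"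
      using assms(12) by (simp_all add: d_def)
    note offset = internal_node_offset [OF pos(2) True assms(3) d]
    have \<psi>: "\<psi> = 3 * \<phi>\<^sub>1 + \<phi>\<^sub>2"
      by (simp add: assms(13) \<phi>s)
    have \<mu>: "3 * \<mu>\<^sub>1 + \<mu>\<^sub>2 = 1" "\<mu>\<^sub>1 * d\<^sup>2 = (\<mu>\<^sub>1 - \<mu>\<^sub>2) * dy\<^sup>2 / 12"
      using pos(3)
      by (simp_all add: assms(14,15) offset(1) add_divide_distrib [symmetric]
        diff_divide_distrib [symmetric] \<psi> [symmetric])
    have \<omega>: "\<omega> = \<mu>\<^sub>1"
      by (simp add: assms(14-16) \<phi>s)
    have node: "node = (\<lambda>s. (x\<^sub>i, y\<^sub>j + (if s = 1 then 1 else - 1) * d))"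
      using True by (simp add: node_def fun_eq_iff)
    show ?thesis
    proof (intro conjI impI)
      assume "i + j \<le> k"
      \<comment> \<open>Here \<open>k \<le> 3\<close> enters: the symmetric moments are valid up to
        degree 3 only.\<close>
      then have ij: "i \<le> k" "j \<le> k" "i + j \<le> 3"
        using k by auto
      show "cell_average x\<^sub>i y\<^sub>j dx dy (\<lambda>z. fst z ^ i * snd z ^ j) =
          decomposition_value x\<^sub>i y\<^sub>j dx dy Q X Y w D (\<lambda>z. fst z ^ i * snd z ^ j)"
        unfolding cell_average_monomial [OF assms(2,3)]
          decomposition_value_monomial [OF assms(8,2) ij(1) assms(9,3) ij(2)]
          symmetric_decomposition_monomial [OF ij(3) assms(2,3) \<mu>]
        by (simp add: D_def node \<omega> atLeastAtMost_1_2 algebra_simps)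
    next
      show "node s \<in> cell x\<^sub>i y\<^sub>j dx dy"
        using offset(2,3) assms(2,3) by (auto simp: node cell_def)
    qed
  next
    case False
    then have \<phi>s: "\<phi>s = \<phi>\<^sub>2" and d: "d = dx / (2 * sqrt 3) * sqrt ((\<phi>\<^sub>2 - \<phi>\<^sub>1) / \<phi>\<^sub>2)"
      using assms(12) by (simp_all add: d_def)
    have le: "\<phi>\<^sub>1 \<le> \<phi>\<^sub>2"
      using False by simp
    note offset = internal_node_offset [OF pos(1) le assms(2) d]
    have \<psi>: "\<psi> = 3 * \<phi>\<^sub>2 + \<phi>\<^sub>1"
      by (simp add: assms(13) \<phi>s)
    have \<mu>: "3 * \<mu>\<^sub>2 + \<mu>\<^sub>1 = 1" "\<mu>\<^sub>2 * d\<^sup>2 = (\<mu>\<^sub>2 - \<mu>\<^sub>1) * dx\<^sup>2 / 12"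
      using pos(3)
      by (simp_all add: assms(14,15) offset(1) add_divide_distrib [symmetric]
        diff_divide_distrib [symmetric] \<psi> [symmetric])
    have \<omega>: "\<omega> = \<mu>\<^sub>2"
      by (simp add: assms(14-16) \<phi>s)
    have node: "node = (\<lambda>s. (x\<^sub>i + (if s = 1 then 1 else - 1) * d, y\<^sub>j))"
      using False by (simp add: node_def fun_eq_iff)
    show ?thesis
    proof (intro conjI impI)
      assume "i + j \<le> k"
      then have ij: "i \<le> k" "j \<le> k" "j + i \<le> 3"
        using k by auto
      show "cell_average x\<^sub>i y\<^sub>j dx dy (\<lambda>z. fst z ^ i * snd z ^ j) =
          decomposition_value x\<^sub>i y\<^sub>j dx dy Q X Y w D (\<lambda>z. fst z ^ i * snd z ^ j)"
        unfolding cell_average_monomial [OF assms(2,3)]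
          decomposition_value_monomial [OF assms(8,2) ij(1) assms(9,3) ij(2)]
          \<comment> \<open>The product is swapped because the symmetric identity is applied with
            the two coordinates exchanged.\<close>
          mult.commute [of "interval_moment x\<^sub>i dx i" "interval_moment y\<^sub>j dy j"]
          symmetric_decomposition_monomial [OF ij(3) assms(3,2) \<mu>]
        by (simp add: D_def node \<omega> atLeastAtMost_1_2 algebra_simps)
    next
      show "node s \<in> cell x\<^sub>i y\<^sub>j dx dy"
        using offset(2,3) assms(2,3) by (auto simp: node cell_def)
    qed
  qed
  have weights: "\<mu>\<^sub>1 > 0" "\<mu>\<^sub>2 > 0" "\<omega> > 0" "\<mu>\<^sub>1 + \<mu>\<^sub>2 + 2 * \<omega> = 1"
    using pos by (simp_all add: assms(14-16) add_divide_distrib [symmetric] assms(13) [symmetric])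
  have "feasible_decomposition k x\<^sub>i y\<^sub>j dx dy Q X Y w D"
    unfolding feasible_decomposition_def
    using weights exact_and_inside
    by (auto intro: decomposition_exact_poly2I simp: D_def)
  moreover have "cfl_min dx dy a\<^sub>1 a\<^sub>2 D' \<le> cfl_min dx dy a\<^sub>1 a\<^sub>2 D"
    if "feasible_decomposition k x\<^sub>i y\<^sub>j dx dy Q X Y w D'" for D'
  proof -
    define m where "m = cfl_min dx dy a\<^sub>1 a\<^sub>2 D'"
    have "m \<le> weight1_minus D' * dx / a\<^sub>1" "m \<le> weight1_plus D' * dx / a\<^sub>1"
      "m \<le> weight2_minus D' * dy / a\<^sub>2" "m \<le> weight2_plus D' * dy / a\<^sub>2"
      by (simp_all add: m_def cfl_min_def)
    then have m: "m * \<phi>\<^sub>1 \<le> weight1_minus D'" "m * \<phi>\<^sub>1 \<le> weight1_plus D'"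
      "m * \<phi>\<^sub>2 \<le> weight2_minus D'" "m * \<phi>\<^sub>2 \<le> weight2_plus D'"
      using assms(2-5) by (simp_all add: assms(10,11) field_simps)
    note bounds = feasible_edge_weight_bounds [OF that assms(8,9,2,3) k(1)]
    have "2 * (3 * (m * \<phi>\<^sub>1) + m * \<phi>\<^sub>2) \<le> 1" "2 * (m * \<phi>\<^sub>1 + 3 * (m * \<phi>\<^sub>2)) \<le> 1"
      using bounds m by (simp_all add: algebra_simps)
    \<comment> \<open>\<psi> is the larger of \<open>3 * \<phi>\<^sub>1 + \<phi>\<^sub>2\<close> and
      \<open>\<phi>\<^sub>1 + 3 * \<phi>\<^sub>2\<close>, so one of the two bounds is the
      claim.\<close>
    then have "2 * (m * \<psi>) \<le> 1"
      by (simp add: assms(12,13) max_def algebra_simps)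
    then have "m \<le> 1 / (2 * \<psi>)"
      using pos(3) by (simp add: field_simps)
    \<comment> \<open>All four entries of the minimum coincide, since
      \<open>\<mu>\<^sub>1 * dx / a\<^sub>1\<close> and
      \<open>\<mu>\<^sub>2 * dy / a\<^sub>2\<close> both equal \<open>1 / \<psi>\<close>.\<close>
    moreover have "cfl_min dx dy a\<^sub>1 a\<^sub>2 D = 1 / (2 * \<psi>)"
      using assms(2-5) by (simp add: cfl_min_def D_def assms(14,15), simp add: assms(10,11))
    ultimately show ?thesis
      by (simp add: m_def)
  qed
  ultimately have "optimal_decomposition k x\<^sub>i y\<^sub>j dx dy a\<^sub>1 a\<^sub>2 Q X Y w D"
    unfolding optimal_decomposition_def by blast
  moreover have "node = (\<lambda>s. let \<sigma> = (if s = 1 then 1 else - 1) in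
       if \<phi>\<^sub>1 \<ge> \<phi>\<^sub>2
       then (x\<^sub>i, y\<^sub>j + \<sigma> * (dy / (2 * sqrt 3) * sqrt ((\<phi>s - \<phi>\<^sub>2) / \<phi>s)))
       else (x\<^sub>i + \<sigma> * (dx / (2 * sqrt 3) * sqrt ((\<phi>s - \<phi>\<^sub>1) / \<phi>s)), y\<^sub>j))"
    by (simp add: fun_eq_iff node_def d_def)
  ultimately show ?thesis
    unfolding D_def by simp
qed

end
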